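(* Let $F,G:\Omega\to\mathcal{H}$ be norm bounded Bessel mappings for $\mathcal{H}$ with respect to $(\Omega,\mu)$, with norm bounds $L_F$ and $L_G$ and Bessel bounds $B_F$ and $B_G$, respectively. Let $1<p<\infty$, let $q$ be the conjugate exponent, $\frac1p+\frac1q=1$, and let $m\in L^p(\Omega,\mu)$. Then $\mathbf{M}_{m,F,G}$ is a well defined bounded operator that belongs to the Schatten $p$-class $\mathcal{S}_p(\mathcal{H})$, with norm estimate \[ \|\mathbf{M}_{m,F,G}\|_{\mathcal{S}_p}\le\|m\|_p\,(L_FL_G)^{\frac{1}{p}}\,(B_FB_G)^{\frac{1}{2q}}. \]
   Context: $\mathcal{H}$ is a complex Hilbert space with inner product linear in the first and conjugate linear in the second variable, and $(\Omega,\mu)$ is a measure space with positive measure $\mu$. A mapping $F:\Omega\to\mathcal{H}$ is a Bessel mapping with respect to $(\Omega,\mu)$ with Bessel bound $B_F$ if $\omega\mapsto\langle f,F(\omega)\rangle$ is measurable for every $f\in\mathcal{H}$ and $\int_\Omega|\langle f,F(\omega)\rangle|^2\,d\mu(\omega)\le B_F\|f\|^2$ for all $f\in\mathcal{H}$. It is norm bounded with norm bound $L_F$ if $\|F(\omega)\|\le L_F$ for almost every $\omega\in\Omega$. The continuous Bessel multiplier $\mathbf{M}_{m,F,G}:\mathcal{H}\to\mathcal{H}$ with symbol $m:\Omega\to\mathbb{C}$ (measurable) is the operator weakly defined by $\langle\mathbf{M}_{m,F,G}f,g\rangle=\int_\Omega m(\omega)\langle f,F(\omega)\rangle\langle G(\omega),g\rangle\,d\mu(\omega)$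 for all $f,g\in\mathcal{H}$; "well defined" means that the integral exists for all $f,g$ and determines such an operator. $\mathcal{S}_p(\mathcal{H})$ is the Schatten $p$-class of compact operators on $\mathcal{H}$ whose singular values lie in $\ell^p$, with $\|\cdot\|_{\mathcal{S}_p}$ the $\ell^p$-norm of the singular values. *)

theory Defs
  imports "HOL-Analysis.Analysis"
begin

text \<open>
  Complex Hilbert spaces of arbitrary dimension. Linearity of the inner product is in the first
  argument. Positive definiteness follows from \<open>norm_eq_sqrt_cinner\<close> and the norm axioms,
  and completeness comes from the class \<^class>\<open>banach\<close>.
\<close>

class complex_hilbert = banach +
  fixes scaleC :: "complex \<Rightarrow> 'a \<Rightarrow> 'a" (infixr "*\<^sub>C" 75)
    and cinner :: "'a \<Rightarrow> 'a \<Rightarrow> complex"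
  assumes scaleC_add_right: "a *\<^sub>C (x + y) = a *\<^sub>C x + a *\<^sub>C y"
    and scaleC_add_left: "(a + b) *\<^sub>C x = a *\<^sub>C x + b *\<^sub>C x"
    and scaleC_scaleC: "a *\<^sub>C (b *\<^sub>C x) = (a * b) *\<^sub>C x"
    and scaleC_of_real: "complex_of_real r *\<^sub>C x = scaleR r x"
    and cinner_commute: "cinner x y = cnj (cinner y x)"
    and cinner_add_left: "cinner (x + y) z = cinner x z + cinner y z"
    and cinner_scaleC_left: "cinner (a *\<^sub>C x) y = a * cinner x y"
    and norm_eq_sqrt_cinner: "norm x = sqrt (Re (cinner x x))"

global_interpretation complex_vs:
  vector_space "scaleC :: complex \<Rightarrow> 'a \<Rightarrow> 'a::complex_hilbert"
proof
  show "1 *\<^sub>C x = x" for x :: 'a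
    using scaleC_of_real[of 1 x] by simp
qed (simp_all add: scaleC_add_right scaleC_add_left scaleC_scaleC)

definition bounded_clinear :: "('a::complex_hilbert \<Rightarrow> 'a) \<Rightarrow> bool" where
  "bounded_clinear T \<longleftrightarrow> bounded_linear T \<and> (\<forall>c x. T (c *\<^sub>C x) = c *\<^sub>C T x)"

definition compact_operator :: "('a::complex_hilbert \<Rightarrow> 'a) \<Rightarrow> bool" where
  "compact_operator T \<longleftrightarrow> bounded_clinear T \<and> compact (closure (T ` cball 0 1))"

definition cadjoint :: "('a::complex_hilbert \<Rightarrow> 'a) \<Rightarrow> 'a \<Rightarrow> 'a" where
  "cadjoint T = (THE S. \<forall>x y. cinner (T x) y = cinner x (S y))"

text \<open>
  The singular values of a compact operator \<open>T\<close> are the square roots of the positive eigenvalues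
  of \<open>T\<^sup>*T\<close>, each repeated according to the dimension of its eigenspace. They are encoded as a set
  together with a multiplicity function. Singular values equal to \<open>0\<close> are left out, as they do not
  contribute to \<open>\<ell>\<^sup>p\<close> sums. For infinite-dimensional spaces \<open>dim\<close> is \<open>0\<close>; this does not occur for
  compact \<open>T\<close>, to which the Schatten classes are restricted.
\<close>

definition sv_eigenspace :: "('a::complex_hilbert \<Rightarrow> 'a) \<Rightarrow> real \<Rightarrow> 'a set" where
  "sv_eigenspace T s = {x. cadjoint T (T x) = complex_of_real (s\<^sup>2) *\<^sub>C x}"

definition singular_values :: "('a::complex_hilbert \<Rightarrow> 'a) \<Rightarrow> real set" where
  "singular_values T = {s. s > 0 \<and> (\<exists>x \<in> sv_eigenspace T s. x \<noteq> 0)}"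

definition sv_mult :: "('a::complex_hilbert \<Rightarrow> 'a) \<Rightarrow> real \<Rightarrow> nat" where
  "sv_mult T s = complex_vs.dim (sv_eigenspace T s)"

definition schatten_class :: "real \<Rightarrow> ('a::complex_hilbert \<Rightarrow> 'a) set" where
  "schatten_class p = {T. compact_operator T \<and>
     (\<lambda>s. real (sv_mult T s) * s powr p) summable_on singular_values T}"

definition schatten_norm :: "real \<Rightarrow> ('a::complex_hilbert \<Rightarrow> 'a) \<Rightarrow> real" where
  "schatten_norm p T =
     (\<Sum>\<^sub>\<infinity>s\<in>singular_values T. real (sv_mult T s) * s powr p) powr (1 / p)"

definition bessel_mapping :: "'w measure \<Rightarrow> ('w \<Rightarrow> 'a::complex_hilbert) \<Rightarrow> real \<Rightarrow> bool" where
  "bessel_mapping M F B \<longleftrightarrow>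
     (\<forall>f. (\<lambda>\<omega>. cinner f (F \<omega>)) \<in> borel_measurable M) \<and>
     (\<forall>f. integrable M (\<lambda>\<omega>. (cmod (cinner f (F \<omega>)))\<^sup>2) \<and>
          (LINT \<omega>|M. (cmod (cinner f (F \<omega>)))\<^sup>2) \<le> B * (norm f)\<^sup>2)"

definition norm_bounded_mapping :: "'w measure \<Rightarrow> ('w \<Rightarrow> 'a::complex_hilbert) \<Rightarrow> real \<Rightarrow> bool" where
  "norm_bounded_mapping M F L \<longleftrightarrow> (AE \<omega> in M. norm (F \<omega>) \<le> L)"

definition in_Lp :: "real \<Rightarrow> 'w measure \<Rightarrow> ('w \<Rightarrow> complex) \<Rightarrow> bool" where
  "in_Lp p M m \<longleftrightarrow> m \<in> borel_measurable M \<and> integrable M (\<lambda>\<omega>. cmod (m \<omega>) powr p)"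

definition Lp_norm :: "real \<Rightarrow> 'w measure \<Rightarrow> ('w \<Rightarrow> complex) \<Rightarrow> real" where
  "Lp_norm p M m = (LINT \<omega>|M. cmod (m \<omega>) powr p) powr (1 / p)"

definition multiplier_integrand ::
  "('w \<Rightarrow> complex) \<Rightarrow> ('w \<Rightarrow> 'a::complex_hilbert) \<Rightarrow> ('w \<Rightarrow> 'a) \<Rightarrow> 'a \<Rightarrow> 'a \<Rightarrow> 'w \<Rightarrow> complex" where
  "multiplier_integrand m F G f g \<omega> = m \<omega> * cinner f (F \<omega>) * cinner (G \<omega>) g"

definition is_multiplier ::
  "'w measure \<Rightarrow> ('w \<Rightarrow> complex) \<Rightarrow> ('w \<Rightarrow> 'a::complex_hilbert) \<Rightarrow> ('w \<Rightarrow> 'a) \<Rightarrow> ('a \<Rightarrow> 'a) \<Rightarrow> bool" where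
  "is_multiplier M m F G T \<longleftrightarrow>
     (\<forall>f g. cinner (T f) g = (LINT \<omega>|M. multiplier_integrand m F G f g \<omega>))"

definition multiplier_well_defined ::
  "'w measure \<Rightarrow> ('w \<Rightarrow> complex) \<Rightarrow> ('w \<Rightarrow> 'a::complex_hilbert) \<Rightarrow> ('w \<Rightarrow> 'a) \<Rightarrow> bool" where
  "multiplier_well_defined M m F G \<longleftrightarrow>
     (\<forall>f g. integrable M (multiplier_integrand m F G f g)) \<and> (\<exists>!T. is_multiplier M m F G T)"

definition multiplier ::
  "'w measure \<Rightarrow> ('w \<Rightarrow> complex) \<Rightarrow> ('w \<Rightarrow> 'a::complex_hilbert) \<Rightarrow> ('w \<Rightarrow> 'a) \<Rightarrow> 'a \<Rightarrow> 'a" where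
  "multiplier M m F G = (THE T. is_multiplier M m F G T)"

end

theory Submission
  imports Defs
begin

text \<open>
  Hoelder's inequality and Bessel's inequality for finite orthonormal families give the estimate
  directly, with the stated constant and without interpolation between trace class and bounded operators.

  For \<open>f, g\<close> write \<open>w = |\<langle>f, F\<rangle>| |\<langle>G, g\<rangle>|\<close>. The integrand of the multiplier has absolute value
  \<open>|m| w = (|m|\<^sup>p w)\<^bsup>1/p\<^esup> w\<^bsup>1/q\<^esup>\<close>, so that by Hoelder
  \<open>|\<langle>T f, g\<rangle>|\<^sup>p \<le> (\<integral> |m|\<^sup>p w) (\<integral> w)\<^bsup>p/q\<^esup>\<close>. For unit vectors the Cauchy--Schwarz inequality and the Bessel
  bounds give \<open>\<integral> w \<le> (B\<^sub>F B\<^sub>G)\<^bsup>1/2\<^esup>\<close>. If \<open>f\<close> and \<open>g\<close> run through finite orthonormal families \<open>e\<^sub>i\<close> and \<open>g\<^sub>i\<close>,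
  then the corresponding functions \<open>w\<^sub>i\<close> satisfy \<open>\<Sum> w\<^sub>i \<le> \<parallel>F\<parallel> \<parallel>G\<parallel> \<le> L\<^sub>F L\<^sub>G\<close> almost everywhere, and hence
  \<open>\<Sum> |\<langle>T e\<^sub>i, g\<^sub>i\<rangle>|\<^sup>p \<le> \<parallel>m\<parallel>\<^sub>p\<^sup>p L\<^sub>F L\<^sub>G (B\<^sub>F B\<^sub>G)\<^bsup>p/(2q)\<^esup>\<close>, uniformly over all such pairs of families
  (\<open>is_multiplier_diagonal_sums_bounded\<close>). The operator \<open>T\<close> itself comes from the same bound for a single
  pair \<open>(f, g)\<close> and the Riesz representation theorem (\<open>bounded_sesquilinear_form_operator\<close>).

  A uniform bound \<open>C\<close> on these diagonal sums already implies that \<open>T\<close> is in the Schatten class, with norm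
  at most \<open>C\<^bsup>1/p\<^esup>\<close> (\<open>diagonal_sums_bounded_imp_schatten\<close>). Compactness holds since only finitely many
  orthogonal directions can carry entries of size \<open>\<epsilon>\<close>, so that \<open>T\<close> is within \<open>\<epsilon>\<close> of an operator of
  finite rank. For the norm, orthonormal eigenvectors \<open>e\<close> of \<open>T\<^sup>*T\<close> and their normalised images under \<open>T\<close>
  form two orthonormal families whose diagonal entries are exactly the singular values.
\<close>

section \<open>Complex inner products\<close>

lemma cinner_zero_left [simp]: "cinner 0 (y::'a::complex_hilbert) = 0"
  using cinner_add_left[of 0 0 y] by simp

lemma cinner_minus_left: "cinner (- x) (y::'a::complex_hilbert) = - cinner x y"
  using cinner_add_left[of x "- x" y] by (simp add: add_eq_0_iff)

lemma cinner_diff_left: "cinner (x - y) (z::'a::complex_hilbert) = cinner x z - cinner y z"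
  using cinner_add_left[of x "- y" z] by (simp add: cinner_minus_left)

lemma cinner_add_right: "cinner (x::'a::complex_hilbert) (y + z) = cinner x y + cinner x z"
  by (metis cinner_add_left cinner_commute complex_cnj_add)

lemma cinner_diff_right: "cinner (x::'a::complex_hilbert) (y - z) = cinner x y - cinner x z"
  by (metis cinner_diff_left cinner_commute complex_cnj_diff)

lemma cinner_zero_right [simp]: "cinner (x::'a::complex_hilbert) 0 = 0"
  by (metis cinner_zero_left cinner_commute complex_cnj_zero)

lemma cinner_scaleC_right: "cinner (x::'a::complex_hilbert) (a *\<^sub>C y) = cnj a * cinner x y"
  by (metis cinner_scaleC_left cinner_commute complex_cnj_mult)

lemma cinner_sum_left: "cinner (sum f I) (y::'a::complex_hilbert) = (\<Sum>i\<in>I. cinner (f i) y)"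
  by (induction I rule: infinite_finite_induct) (auto simp: cinner_add_left)

lemma cinner_sum_right: "cinner (x::'a::complex_hilbert) (sum f I) = (\<Sum>i\<in>I. cinner x (f i))"
  by (induction I rule: infinite_finite_induct) (auto simp: cinner_add_right)

lemma cmod_cinner_commute: "cmod (cinner x y) = cmod (cinner y (x::'a::complex_hilbert))"
  by (metis cinner_commute complex_mod_cnj)

lemma Re_cinner_self: "Re (cinner x x) = (norm (x::'a::complex_hilbert))\<^sup>2"
proof -
  have "0 \<le> Re (cinner x x)"
    using norm_eq_sqrt_cinner[of x] norm_ge_zero[of x] by (metis real_sqrt_ge_0_iff)
  then show ?thesis
    by (simp add: norm_eq_sqrt_cinner)
qed

lemma cinner_self: "cinner x x = (complex_of_real (norm (x::'a::complex_hilbert)))\<^sup>2"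
proof -
  have "Im (cinner x x) = 0"
    using cinner_commute[of x x] by (metis cnj.simps(2) equal_neg_zero)
  then show ?thesis
    by (simp add: complex_eq_iff Re_cinner_self)
qed

lemma mult_cnj_cmod: "z * cnj z = (complex_of_real (cmod z))\<^sup>2"
  by (simp add: complex_norm_square flip: of_real_power)

lemma norm_scaleC: "norm (c *\<^sub>C (x::'a::complex_hilbert)) = cmod c * norm x"
proof -
  have "cinner (c *\<^sub>C x) (c *\<^sub>C x) = (c * cnj c) * cinner x x"
    by (simp add: cinner_scaleC_left cinner_scaleC_right)
  also have "\<dots> = complex_of_real ((cmod c)\<^sup>2 * (norm x)\<^sup>2)"
    by (simp only: mult_cnj_cmod cinner_self of_real_mult of_real_power)
  finally have "cinner (c *\<^sub>C x) (c *\<^sub>C x) = complex_of_real ((cmod c)\<^sup>2 * (norm x)\<^sup>2)" .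
  then have "(norm (c *\<^sub>C x))\<^sup>2 = (cmod c * norm x)\<^sup>2"
    by (metis Re_cinner_self Re_complex_of_real power_mult_distrib)
  then show ?thesis
    by simp
qed

lemma norm_add_square:
  "(norm (x + y))\<^sup>2 = (norm x)\<^sup>2 + (norm (y::'a::complex_hilbert))\<^sup>2 + 2 * Re (cinner x y)"
proof -
  have "Re (cinner y x) = Re (cinner x y)"
    by (metis cinner_commute cnj.simps(1))
  then show ?thesis
    by (simp add: cinner_add_left cinner_add_right flip: Re_cinner_self)
qed

text \<open>The real part is controlled by the triangle inequality for the norm, which the class provides;
  rotating \<open>x\<close> by a phase makes the inner product real.\<close>

lemma cinner_Cauchy_Schwarz: "cmod (cinner x y) \<le> norm x * norm (y::'a::complex_hilbert)"
proof -
  have Re_le: "Re (cinner u y) \<le> norm u * norm y" for u :: 'a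
  proof -
    have "(norm (u + y))\<^sup>2 \<le> (norm u + norm y)\<^sup>2"
      by (intro power_mono norm_triangle_ineq) auto
    then show ?thesis
      by (simp add: norm_add_square power2_sum)
  qed
  define c where "c = cnj (sgn (cinner x y))"
  have "c * cinner x y = complex_of_real (cmod (cinner x y))"
    unfolding c_def sgn_eq
    by (cases "cinner x y = 0")
       (auto simp: complex_norm_square[symmetric] field_simps power2_eq_square
          simp flip: of_real_mult)
  moreover have "cmod c \<le> 1"
    by (simp add: c_def norm_sgn)
  then have "norm (c *\<^sub>C x) * norm y \<le> norm x * norm y"
    by (intro mult_right_mono) (auto simp: norm_scaleC mult_left_le_one_le)
  ultimately show ?thesis
    using Re_le[of "c *\<^sub>C x"] by (simp add: cinner_scaleC_left)
qed

lemma cinner_eqI: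
  assumes "\<And>z. cinner x z = cinner y (z::'a::complex_hilbert)"
  shows "x = y"
proof -
  have "cinner (x - y) (x - y) = 0"
    by (simp add: cinner_diff_left assms)
  then show ?thesis
    by (simp add: cinner_self)
qed

section \<open>Finite orthonormal families\<close>

definition orthonormal_family :: "'i set \<Rightarrow> ('i \<Rightarrow> 'a::complex_hilbert) \<Rightarrow> bool" where
  "orthonormal_family I e \<longleftrightarrow> (\<forall>i\<in>I. \<forall>j\<in>I. cinner (e i) (e j) = (if i = j then 1 else 0))"

lemma orthonormal_family_norm:
  assumes "orthonormal_family I e" "i \<in> I"
  shows "norm (e i) = 1"
proof -
  have "(norm (e i))\<^sup>2 = 1"
    using assms by (simp add: orthonormal_family_def flip: Re_cinner_self)
  then show ?thesis
    by (simp add: power2_eq_1_iff) (use norm_ge_zero[of "e i"] in linarith)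
qed

lemma orthonormal_family_insert:
  assumes "orthonormal_family I e" "i \<notin> I" "norm v = 1" "\<And>j. j \<in> I \<Longrightarrow> cinner v (e j) = 0"
  shows "orthonormal_family (insert i I) (e(i := v))"
proof -
  have "cinner (e j) v = 0" if "j \<in> I" for j
    using assms(4)[OF that] by (metis cinner_commute complex_cnj_zero)
  then show ?thesis
    using assms unfolding orthonormal_family_def by (auto simp: cinner_self[of v])
qed

text \<open>The component of \<open>x\<close> orthogonal to the span of the family \<open>e\<close>, provided that the family is
  orthonormal.\<close>

definition orthonormal_residual :: "'i set \<Rightarrow> ('i \<Rightarrow> 'a::complex_hilbert) \<Rightarrow> 'a \<Rightarrow> 'a" where
  "orthonormal_residual I e x = x - (\<Sum>i\<in>I. cinner x (e i) *\<^sub>C e i)"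

lemma orthonormal_residual_decomp:
  "x = orthonormal_residual I e x + (\<Sum>i\<in>I. cinner x (e i) *\<^sub>C e i)"
  by (simp add: orthonormal_residual_def)

lemma cinner_orthonormal_residual:
  assumes "finite I" "orthonormal_family I e" "j \<in> I"
  shows "cinner (orthonormal_residual I e x) (e j) = 0"
proof -
  have "(\<Sum>i\<in>I. cinner x (e i) * cinner (e i) (e j)) = (\<Sum>i\<in>I. if i = j then cinner x (e j) else 0)"
    using assms(2,3) by (intro sum.cong) (auto simp: orthonormal_family_def)
  then show ?thesis
    using assms by (simp add: orthonormal_residual_def cinner_diff_left cinner_sum_left cinner_scaleC_left)
qed

lemma cinner_orthonormal_residual_self:
  assumes "finite I" "orthonormal_family I e"
  shows "cinner x (orthonormal_residual I e x) = (complex_of_real (norm (orthonormal_residual I e x)))\<^sup>2"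
proof -
  let ?r = "orthonormal_residual I e x"
  have "cinner x ?r = cinner (?r + (\<Sum>i\<in>I. cinner x (e i) *\<^sub>C e i)) ?r"
    using orthonormal_residual_decomp[of x I e] by simp
  also have "\<dots> = cinner ?r ?r + (\<Sum>i\<in>I. cinner x (e i) * cinner (e i) ?r)"
    by (simp add: cinner_add_left cinner_sum_left cinner_scaleC_left)
  also have "(\<Sum>i\<in>I. cinner x (e i) * cinner (e i) ?r) = 0"
  proof (intro sum.neutral ballI)
    fix i assume "i \<in> I"
    then have "cinner (e i) ?r = 0"
      using cinner_orthonormal_residual[OF assms] by (metis cinner_commute complex_cnj_zero)
    then show "cinner x (e i) * cinner (e i) ?r = 0"
      by simp
  qed
  finally show ?thesis
    by (simp add: cinner_self)
qed

lemma orthonormal_residual_Pythagoras: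
  assumes "finite I" "orthonormal_family I e"
  shows "(norm (orthonormal_residual I e x))\<^sup>2 + (\<Sum>i\<in>I. (cmod (cinner x (e i)))\<^sup>2) = (norm x)\<^sup>2"
proof -
  let ?r = "orthonormal_residual I e x"
  have "cinner x x = cinner x (?r + (\<Sum>i\<in>I. cinner x (e i) *\<^sub>C e i))"
    using orthonormal_residual_decomp[of x I e] by simp
  also have "\<dots> = (complex_of_real (norm ?r))\<^sup>2 + (\<Sum>i\<in>I. cinner x (e i) * cnj (cinner x (e i)))"
    by (simp add: cinner_add_right cinner_sum_right cinner_scaleC_right
        cinner_orthonormal_residual_self[OF assms] mult.commute)
  also have "\<dots> = complex_of_real ((norm ?r)\<^sup>2 + (\<Sum>i\<in>I. (cmod (cinner x (e i)))\<^sup>2))"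
    by (simp add: mult_cnj_cmod)
  finally show ?thesis
    by (metis Re_cinner_self Re_complex_of_real)
qed

lemma norm_orthonormal_residual_le:
  assumes "finite I" "orthonormal_family I e"
  shows "norm (orthonormal_residual I e x) \<le> norm x"
proof -
  have "0 \<le> (\<Sum>i\<in>I. (cmod (cinner x (e i)))\<^sup>2)"
    by (intro sum_nonneg) simp
  then have "(norm (orthonormal_residual I e x))\<^sup>2 \<le> (norm x)\<^sup>2"
    using orthonormal_residual_Pythagoras[OF assms, of x] by linarith
  then show ?thesis
    by (rule power2_le_imp_le) simp
qed

lemma orthonormal_Bessel:
  assumes "finite I" "orthonormal_family I e"
  shows "(\<Sum>i\<in>I. (cmod (cinner x (e i)))\<^sup>2) \<le> (norm x)\<^sup>2"
  using orthonormal_residual_Pythagoras[OF assms, of x]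
    zero_le_power2[of "norm (orthonormal_residual I e x)"] by linarith

text \<open>The Cauchy--Schwarz inequality for sums, combined with Bessel's inequality for each of the two
  families. Applied to \<open>F \<omega>\<close> and \<open>G \<omega>\<close>, it is what turns norm bounds on the mappings into a bound that
  does not depend on the size of the families.\<close>

lemma orthonormal_Bessel_product:
  assumes "finite I" "orthonormal_family I e" "orthonormal_family I g"
  shows "(\<Sum>i\<in>I. cmod (cinner x (e i)) * cmod (cinner y (g i))) \<le> norm x * norm y"
proof -
  have "(\<Sum>i\<in>I. cmod (cinner x (e i)) * cmod (cinner y (g i)))\<^sup>2
      \<le> (\<Sum>i\<in>I. (cmod (cinner x (e i)))\<^sup>2) * (\<Sum>i\<in>I. (cmod (cinner y (g i)))\<^sup>2)"
    by (rule Cauchy_Schwarz_ineq_sum)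
  also have "\<dots> \<le> (norm x)\<^sup>2 * (norm y)\<^sup>2"
    by (intro mult_mono orthonormal_Bessel assms sum_nonneg) auto
  finally show ?thesis
    unfolding power_mult_distrib[symmetric] by (rule power2_le_imp_le) simp
qed

text \<open>Gram--Schmidt: the residual of a new basis vector is nonzero by independence, and
  normalising it extends the orthonormal set.\<close>

lemma independent_imp_orthonormal:
  fixes B :: "'a::complex_hilbert set"
  assumes "finite B" "complex_vs.independent B"
  obtains E where "finite E" "card E = card B" "E \<subseteq> complex_vs.span B"
    "orthonormal_family E (\<lambda>x. x)"
proof -
  have "\<exists>E. finite E \<and> card E = card B \<and> E \<subseteq> complex_vs.span B \<and> orthonormal_family E (\<lambda>x. x)"
    using assms
  proof (induction B rule: finite_induct)
    case empty
    then show ?case by (intro exI[of _ "{}"]) (auto simp: orthonormal_family_def)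
  next
    case (insert b B)
    then have b: "b \<notin> complex_vs.span B" and ind: "complex_vs.independent B"
      by (auto simp: complex_vs.independent_insert)
    from insert.IH[OF ind] obtain E where E: "finite E" "card E = card B"
      "E \<subseteq> complex_vs.span B" "orthonormal_family E (\<lambda>x. x)" by blast
    define v where "v = orthonormal_residual E (\<lambda>x. x) b"
    define u where "u = complex_of_real (1 / norm v) *\<^sub>C v"
    have proj: "(\<Sum>x\<in>E. cinner b x *\<^sub>C x) \<in> complex_vs.span B"
      using E(3) by (intro complex_vs.span_sum complex_vs.span_scale) auto
    have "v \<noteq> 0"
    proof
      assume "v = 0"
      then have "b = (\<Sum>x\<in>E. cinner b x *\<^sub>C x)"
        by (simp add: v_def orthonormal_residual_def)
      then show False using proj b by simp
    qed
    then have nu: "norm u = 1"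
      by (simp add: u_def norm_scaleC norm_divide)
    have orth: "cinner u x = 0" if "x \<in> E" for x
      using cinner_orthonormal_residual[OF E(1,4) that, of b]
      by (simp add: u_def v_def cinner_scaleC_left)
    have "u \<notin> E"
    proof
      assume "u \<in> E"
      from orth[OF this] nu show False by (simp add: cinner_self)
    qed
    have span_mono: "complex_vs.span B \<subseteq> complex_vs.span (insert b B)"
      by (intro complex_vs.span_mono) auto
    have "u \<in> complex_vs.span (insert b B)"
      unfolding u_def v_def orthonormal_residual_def
      using proj span_mono
      by (intro complex_vs.span_scale complex_vs.span_diff) (auto intro: complex_vs.span_base)
    moreover have "orthonormal_family (insert u E) (\<lambda>x. x)"
      using orthonormal_family_insert[OF E(4) \<open>u \<notin> E\<close> nu orth]
      by (simp add: fun_upd_idem)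
    ultimately show ?case
      using E insert.hyps \<open>u \<notin> E\<close> span_mono
      by (intro exI[of _ "insert u E"]) auto
  qed
  then show ?thesis using that by blast
qed

section \<open>Bounded sesquilinear forms and adjoints\<close>

lemma parallelogram_law:
  "(norm (x - y))\<^sup>2 = 2 * (norm x)\<^sup>2 + 2 * (norm (y::'a::complex_hilbert))\<^sup>2 - (norm (x + y))\<^sup>2"
  using norm_add_square[of x y] norm_add_square[of x "- y"]
  by (simp add: cinner_diff_right[of x 0 y, simplified])

text \<open>
  The representing vector in the Riesz theorem is the minimiser of \<open>J x = \<parallel>x\<parallel>\<^sup>2 - 2 Re (\<phi> x)\<close>.
  Minimising sequences are Cauchy by the parallelogram law, and the first variation of \<open>J\<close> at the minimiser \<open>z\<close> says
  that \<open>Re \<langle>x, z\<rangle> = Re (\<phi> x)\<close>; replacing \<open>x\<close> by \<open>\<i> x\<close> gives the imaginary parts.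
\<close>

theorem Riesz_representation:
  fixes \<phi> :: "'a::complex_hilbert \<Rightarrow> complex"
  assumes add: "\<And>x y. \<phi> (x + y) = \<phi> x + \<phi> y"
    and scale: "\<And>c x. \<phi> (c *\<^sub>C x) = c * \<phi> x"
    and bound: "\<And>x. cmod (\<phi> x) \<le> K * norm x"
  obtains z where "\<And>x. \<phi> x = cinner x z"
proof -
  define J where "J x = (norm x)\<^sup>2 - 2 * Re (\<phi> x)" for x
  have scaleR: "\<phi> (r *\<^sub>R x) = complex_of_real r * \<phi> x" for r x
    using scale[of "complex_of_real r" x] by (simp add: scaleC_of_real)
  have blin: "bounded_linear \<phi>"
    by (rule bounded_linear_intro[of _ K]) (auto simp: add scaleR scaleR_conv_of_real bound mult.commute)
  have J_bdd: "- K\<^sup>2 \<le> J x" for x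
  proof -
    have "Re (\<phi> x) \<le> K * norm x"
      using complex_Re_le_cmod[of "\<phi> x"] bound[of x] by linarith
    moreover have "0 \<le> (norm x - K)\<^sup>2" by simp
    ultimately show ?thesis
      by (simp add: J_def power2_eq_square algebra_simps)
  qed
  define I where "I = (INF x. J x)"
  have bdd: "bdd_below (range J)"
    using J_bdd by (intro bdd_belowI[of _ "- K\<^sup>2"]) auto
  have I_le: "I \<le> J x" for x
    unfolding I_def by (rule cINF_lower[OF bdd]) simp
  have "\<exists>x. J x < I + inverse (real (Suc n))" for n
  proof -
    have "(INF x. J x) < I + inverse (real (Suc n))" by (simp add: I_def)
    then show ?thesis
      using bdd by (subst (asm) cINF_less_iff) auto
  qed
  then obtain X where X: "\<And>n. J (X n) < I + inverse (real (Suc n))" by metis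
  \<comment> \<open>compare \<open>J\<close> at the midpoint with its infimum\<close>
  have close: "(norm (x - y))\<^sup>2 \<le> 2 * (J x - I) + 2 * (J y - I)" for x y
  proof -
    have "4 * J ((1/2) *\<^sub>R (x + y)) = (norm (x + y))\<^sup>2 - 4 * Re (\<phi> x) - 4 * Re (\<phi> y)"
      unfolding J_def norm_scaleR scaleR add by (simp add: power_divide algebra_simps)
    then show ?thesis
      using I_le[of "(1/2) *\<^sub>R (x + y)"] parallelogram_law[of x y] by (simp add: J_def)
  qed
  have "Cauchy X"
  proof (rule metric_CauchyI)
    fix \<epsilon> :: real assume "0 < \<epsilon>"
    then obtain N where N: "inverse (real (Suc N)) < \<epsilon>\<^sup>2 / 4"
      using reals_Archimedean[of "\<epsilon>\<^sup>2 / 4"] by auto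
    show "\<exists>N. \<forall>m\<ge>N. \<forall>n\<ge>N. dist (X m) (X n) < \<epsilon>"
    proof (intro exI allI impI)
      fix m n assume mn: "N \<le> m" "N \<le> n"
      have near: "J (X k) - I < \<epsilon>\<^sup>2 / 4" if "N \<le> k" for k
      proof -
        have "inverse (real (Suc k)) \<le> inverse (real (Suc N))"
          using that by (intro le_imp_inverse_le) auto
        then show ?thesis
          using X[of k] N by (smt (verit))
      qed
      have "(norm (X m - X n))\<^sup>2 < \<epsilon>\<^sup>2"
        using close[of "X m" "X n"] near[OF mn(1)] near[OF mn(2)] by (simp add: field_simps)
      then show "dist (X m) (X n) < \<epsilon>"
        using \<open>0 < \<epsilon>\<close> by (simp add: dist_norm power2_less_imp_less)
    qed
  qed
  then obtain z where z: "X \<longlonglongrightarrow> z"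
    using Cauchy_convergent convergent_def by blast
  have "(\<lambda>n. J (X n)) \<longlonglongrightarrow> J z"
    unfolding J_def by (intro tendsto_intros z bounded_linear.tendsto[OF blin])
  moreover have "(\<lambda>n. I + inverse (real (Suc n))) \<longlonglongrightarrow> I + 0"
    by (intro tendsto_intros LIMSEQ_inverse_real_of_nat)
  ultimately have "J z \<le> I + 0"
    using X by (intro LIMSEQ_le) (auto intro!: exI[of _ 0] less_imp_le)
  then have min: "J z \<le> J x" for x
    using I_le[of x] by simp
  have Re_eq: "Re (cinner x z) = Re (\<phi> x)" for x
  proof -
    define d where "d = Re (cinner x z) - Re (\<phi> x)"
    have quad: "0 \<le> t\<^sup>2 * (norm x)\<^sup>2 + 2 * t * d" for t :: real
    proof -
      have "(norm (t *\<^sub>R x + z))\<^sup>2 = t\<^sup>2 * (norm x)\<^sup>2 + (norm z)\<^sup>2 + 2 * t * Re (cinner x z)"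
        unfolding norm_add_square
        by (simp add: power_mult_distrib cinner_scaleC_left flip: scaleC_of_real)
          (simp add: scaleC_of_real power_mult_distrib)
      then show ?thesis
        using min[of "t *\<^sub>R x + z"]
        by (simp add: J_def d_def add scaleR algebra_simps)
    qed
    \<comment> \<open>at \<open>t = - d / (\<parallel>x\<parallel>\<^sup>2 + 1)\<close> the linear term beats the quadratic one unless \<open>d = 0\<close>\<close>
    define t where "t = - d / ((norm x)\<^sup>2 + 1)"
    have pos: "0 < (norm x)\<^sup>2 + 1" by (simp add: add_nonneg_pos)
    then have d: "d = - t * ((norm x)\<^sup>2 + 1)" by (simp add: t_def)
    have "0 \<le> - (t\<^sup>2 * ((norm x)\<^sup>2 + 2))"
      using quad[of t] unfolding d by (simp add: algebra_simps power2_eq_square)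
    then have "t = 0"
      by (simp add: mult_le_0_iff) (use pos in linarith)
    then show ?thesis using d by (simp add: d_def)
  qed
  have "\<phi> x = cinner x z" for x
  proof (rule complex_eqI)
    show "Im (\<phi> x) = Im (cinner x z)"
      using Re_eq[of "\<i> *\<^sub>C x"] by (simp add: cinner_scaleC_left scale)
  qed (simp add: Re_eq)
  then show ?thesis using that by blast
qed

text \<open>The Riesz theorem, applied to the second variable for each fixed first one, gives the values of the
  operator; uniqueness of the representing vector makes it linear.\<close>

lemma bounded_sesquilinear_form_operator:
  fixes \<Phi> :: "'a::complex_hilbert \<Rightarrow> 'a \<Rightarrow> complex"
  assumes add_left: "\<And>x y z. \<Phi> (x + y) z = \<Phi> x z + \<Phi> y z"
    and add_right: "\<And>x y z. \<Phi> x (y + z) = \<Phi> x y + \<Phi> x z"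
    and scale_left: "\<And>c x y. \<Phi> (c *\<^sub>C x) y = c * \<Phi> x y"
    and scale_right: "\<And>c x y. \<Phi> x (c *\<^sub>C y) = cnj c * \<Phi> x y"
    and bound: "\<And>x y. cmod (\<Phi> x y) \<le> K * norm x * norm y"
  obtains T where "bounded_clinear T" "\<And>x y. cinner (T x) y = \<Phi> x y"
proof -
  have "\<exists>z. \<forall>y. cinner z y = \<Phi> x y" for x
  proof -
    obtain z where z: "\<And>y. cnj (\<Phi> x y) = cinner y z"
      by (rule Riesz_representation[of "\<lambda>y. cnj (\<Phi> x y)" "K * norm x"])
         (auto simp: add_right scale_right bound)
    have "cinner z y = \<Phi> x y" for y
      using z[of y] by (metis cinner_commute complex_cnj_cnj)
    then show ?thesis by blast
  qed
  then obtain T where T: "\<And>x y. cinner (T x) y = \<Phi> x y" by metis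
  have T_add: "T (x + y) = T x + T y" for x y
    by (rule cinner_eqI) (simp add: T cinner_add_left add_left)
  have T_scale: "T (c *\<^sub>C x) = c *\<^sub>C T x" for c x
    by (rule cinner_eqI) (simp add: T cinner_scaleC_left scale_left)
  have T_bound: "norm (T x) \<le> norm x * K" for x
  proof (cases "T x = 0")
    case True
    have "0 \<le> K * norm x * norm x"
      using bound[of x x] norm_ge_zero order_trans by blast
    then have "0 \<le> K * norm x" 
      by (cases "x = 0") (auto simp: zero_le_mult_iff)
    then show ?thesis using True by (simp add: mult.commute)
  next
    case False
    have "norm (T x) * norm (T x) \<le> K * norm x * norm (T x)"
      using bound[of x "T x"] unfolding T[symmetric] cinner_self
      by (simp add: norm_power power2_eq_square norm_mult)
    then show ?thesis using False by (simp add: mult.commute)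
  qed
  have "bounded_linear T"
    using T_add T_bound T_scale[of "complex_of_real _"]
    by (intro bounded_linear_intro[of _ K]) (auto simp: scaleC_of_real)
  then have "bounded_clinear T"
    by (simp add: bounded_clinear_def T_scale)
  then show ?thesis using that T by blast
qed

lemma bounded_clinear_add: "bounded_clinear T \<Longrightarrow> T (x + y) = T x + T y"
  by (simp add: bounded_clinear_def linear_simps(1))

lemma bounded_clinear_scaleC: "bounded_clinear T \<Longrightarrow> T (c *\<^sub>C x) = c *\<^sub>C T x"
  by (simp add: bounded_clinear_def)

lemma bounded_clinear_sum: "bounded_clinear T \<Longrightarrow> T (sum f I) = (\<Sum>i\<in>I. T (f i))"
  by (simp add: bounded_clinear_def bounded_linear.linear linear_sum)

lemma bounded_clinear_bound:
  assumes "bounded_clinear T"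
  obtains K where "0 < K" "\<And>x. norm (T x) \<le> K * norm x"
  using assms bounded_linear.pos_bounded[of T] unfolding bounded_clinear_def
  by (metis mult.commute)

text \<open>The description that defines \<open>cadjoint\<close> determines it uniquely; existence is
  \<open>bounded_sesquilinear_form_operator\<close> for the form \<open>\<langle>x, T y\<rangle>\<close>.\<close>

lemma cinner_cadjoint:
  fixes T :: "'a::complex_hilbert \<Rightarrow> 'a"
  assumes T: "bounded_clinear T"
  shows "cinner (T x) y = cinner x (cadjoint T y)"
proof -
  obtain K where K: "0 < K" "\<And>x. norm (T x) \<le> K * norm x"
    using bounded_clinear_bound[OF T] by metis
  obtain S where S: "\<And>x y. cinner (S x) y = cinner x (T y)"
  proof (rule bounded_sesquilinear_form_operator[of "\<lambda>x y. cinner x (T y)" K])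
    fix x y :: 'a
    have "cmod (cinner x (T y)) \<le> norm x * norm (T y)"
      by (rule cinner_Cauchy_Schwarz)
    also have "\<dots> \<le> norm x * (K * norm y)"
      by (intro mult_left_mono K) auto
    finally show "cmod (cinner x (T y)) \<le> K * norm x * norm y"
      by (simp add: mult_ac)
  qed (auto simp: cinner_add_left cinner_add_right cinner_scaleC_left cinner_scaleC_right
      bounded_clinear_add[OF T] bounded_clinear_scaleC[OF T])
  have adj: "\<forall>x y. cinner (T x) y = cinner x (S y)"
    using S by (metis cinner_commute)
  have "cadjoint T = S"
    unfolding cadjoint_def
  proof (rule the_equality)
    fix S' assume S': "\<forall>x y. cinner (T x) y = cinner x (S' y)"
    show "S' = S"
    proof
      fix y show "S' y = S y"
        using adj S' by (intro cinner_eqI) (metis cinner_commute)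
    qed
  qed (rule adj)
  then show ?thesis using adj by simp
qed

section \<open>A criterion for membership in a Schatten class\<close>

text \<open>
  The two orthonormal families are the finite set \<open>E\<close>, indexed by itself, and \<open>g\<close>; indexing by the
  vectors of \<open>E\<close> makes it possible to quantify over all finite families without an index type.
\<close>

definition diagonal_sums_bounded :: "real \<Rightarrow> ('a::complex_hilbert \<Rightarrow> 'a) \<Rightarrow> real \<Rightarrow> bool" where
  "diagonal_sums_bounded p T C \<longleftrightarrow>
     (\<forall>E g. finite E \<longrightarrow> orthonormal_family E (\<lambda>e. e) \<longrightarrow> orthonormal_family E g \<longrightarrow>
        (\<Sum>e\<in>E. cmod (cinner (T e) (g e)) powr p) \<le> C)"

text \<open>Used for the ranges of the operators of finite rank that approximate \<open>T\<close>: the image of the unit ball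
  stays in a fixed compact set.\<close>

lemma compact_finite_combinations:
  fixes v :: "'i \<Rightarrow> 'a::complex_hilbert"
  assumes "finite I"
  shows "\<exists>S. compact S \<and> (\<forall>c. (\<forall>i\<in>I. cmod (c i) \<le> r) \<longrightarrow> (\<Sum>i\<in>I. c i *\<^sub>C v i) \<in> S)"
  using assms
proof (induction I rule: finite_induct)
  case empty
  show ?case by (intro exI[of _ "{0}"]) auto
next
  case (insert i I)
  then obtain S where S: "compact S" 
    "\<And>c. (\<forall>i\<in>I. cmod (c i) \<le> r) \<Longrightarrow> (\<Sum>i\<in>I. c i *\<^sub>C v i) \<in> S" by blast
  have "bounded_linear (\<lambda>c. c *\<^sub>C v i)"
    by (rule bounded_linear_intro[of _ "norm (v i)"])
       (auto simp: scaleC_add_left norm_scaleC scaleR_conv_of_real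
         simp flip: scaleC_of_real scaleC_scaleC)
  then have "continuous_on (cball 0 r) (\<lambda>c. c *\<^sub>C v i)"
    by (simp add: linear_continuous_on)
  then have "compact ((\<lambda>c. c *\<^sub>C v i) ` cball 0 r)"
    by (rule compact_continuous_image) simp
  from compact_sums[OF this S(1)] show ?case
  proof (intro exI conjI allI impI)
    fix c assume c: "\<forall>j\<in>insert i I. cmod (c j) \<le> r"
    then have "c i *\<^sub>C v i \<in> (\<lambda>c. c *\<^sub>C v i) ` cball 0 r"
      by (intro imageI) simp
    moreover have "(\<Sum>j\<in>I. c j *\<^sub>C v j) \<in> S" using c by (intro S(2)) simp
    ultimately show "(\<Sum>j\<in>insert i I. c j *\<^sub>C v j)
        \<in> {x + y | x y. x \<in> (\<lambda>c. c *\<^sub>C v i) ` cball 0 r \<and> y \<in> S}"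
      using insert.hyps by auto
  qed
qed

text \<open>
  A family \<open>(E, g)\<close> of largest cardinality with all diagonal entries at least \<open>\<epsilon>\<close> exists, because each
  entry contributes \<open>\<epsilon> powr p\<close> to a bounded sum. By maximality \<open>T\<close> has norm at most \<open>\<epsilon>\<close> as a form on
  \<open>E\<^sup>\<bottom> \<times> g(E)\<^sup>\<bottom>\<close>.
\<close>

lemma diagonal_sums_bounded_small_off_finite:
  assumes p: "0 < p" and "diagonal_sums_bounded p T C" and \<epsilon>: "0 < \<epsilon>"
    and T: "bounded_clinear T"
  obtains E g where "finite E" "orthonormal_family E (\<lambda>e. e)" "orthonormal_family E g"
    "\<And>x y. (\<And>e. e \<in> E \<Longrightarrow> cinner x e = 0) \<Longrightarrow> (\<And>e. e \<in> E \<Longrightarrow> cinner y (g e) = 0) \<Longrightarrow>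
       cmod (cinner (T x) y) \<le> \<epsilon> * norm x * norm y"
proof -
  define P where "P E g \<longleftrightarrow> finite E \<and> orthonormal_family E (\<lambda>e. e) \<and> orthonormal_family E g \<and>
      (\<forall>e\<in>E. \<epsilon> \<le> cmod (cinner (T e) (g e)))" for E and g :: "'a \<Rightarrow> 'a"
  have card_le: "card E \<le> nat \<lfloor>C / \<epsilon> powr p\<rfloor>" if "P E g" for E g
  proof -
    have "real (card E) * \<epsilon> powr p = (\<Sum>e\<in>E. \<epsilon> powr p)" by simp
    also have "\<dots> \<le> (\<Sum>e\<in>E. cmod (cinner (T e) (g e)) powr p)"
      using that p \<epsilon> by (intro sum_mono powr_mono2) (auto simp: P_def)
    also have "\<dots> \<le> C"
      using assms(2) that by (auto simp: diagonal_sums_bounded_def P_def)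
    finally have "real (card E) \<le> C / \<epsilon> powr p"
      using \<epsilon> by (simp add: field_simps)
    then show ?thesis by linarith
  qed
  have "P {} id" by (simp add: P_def orthonormal_family_def)
  then have "\<exists>n. \<exists>E g. P E g \<and> card E = n" by blast
  moreover have "\<And>n. \<exists>E g. P E g \<and> card E = n \<Longrightarrow> n \<le> nat \<lfloor>C / \<epsilon> powr p\<rfloor>"
    using card_le by blast
  ultimately obtain n where "\<exists>E g. P E g \<and> card E = n"
    and n_max: "\<And>k. \<exists>E g. P E g \<and> card E = k \<Longrightarrow> k \<le> n"
    using Nat.ex_has_greatest_nat[of "\<lambda>n. \<exists>E g. P E g \<and> card E = n"] by metis
  then obtain E g where Eg: "P E g" and card_E: "card E = n" by blast
  then have E: "finite E" "orthonormal_family E (\<lambda>e. e)" "orthonormal_family E g"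
    by (auto simp: P_def)
  have unit: "cmod (cinner (T u) w) < \<epsilon>"
    if u: "norm u = 1" "\<And>e. e \<in> E \<Longrightarrow> cinner u e = 0"
      and w: "norm w = 1" "\<And>e. e \<in> E \<Longrightarrow> cinner w (g e) = 0" for u w
  proof (rule ccontr)
    assume large: "\<not> ?thesis"
    have "u \<notin> E"
    proof
      assume "u \<in> E"
      from u(2)[OF this] u(1) show False by (simp add: cinner_self)
    qed
    then have eq: "(g(u := w)) e = g e" if "e \<in> E" for e using that by auto
    have "orthonormal_family (insert u E) (\<lambda>e. e)"
      using orthonormal_family_insert[OF E(2) \<open>u \<notin> E\<close> u] by (simp add: fun_upd_idem)
    then have "P (insert u E) (g(u := w))"
      using orthonormal_family_insert[OF E(3) \<open>u \<notin> E\<close> w] large Eg eq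
      by (auto simp: P_def)
    then have "card (insert u E) \<le> n"
      using n_max by blast
    then show False
      using card_E E(1) \<open>u \<notin> E\<close> by simp
  qed
  have "cmod (cinner (T x) y) \<le> \<epsilon> * norm x * norm y"
    if x: "\<And>e. e \<in> E \<Longrightarrow> cinner x e = 0" and y: "\<And>e. e \<in> E \<Longrightarrow> cinner y (g e) = 0" for x y
  proof (cases "x = 0 \<or> y = 0")
    case True
    have "T 0 = 0" using bounded_clinear_scaleC[OF T, of 0 0] by simp
    with True show ?thesis by auto
  next
    case False
    define u where "u = complex_of_real (1 / norm x) *\<^sub>C x"
    define w where "w = complex_of_real (1 / norm y) *\<^sub>C y"
    have "cmod (cinner (T u) w) < \<epsilon>"
      using False x y by (intro unit) (auto simp: u_def w_def norm_scaleC norm_divide cinner_scaleC_left)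
    moreover have "cmod (cinner (T u) w) = cmod (cinner (T x) y) / (norm x * norm y)"
      by (simp add: u_def w_def bounded_clinear_scaleC[OF T] cinner_scaleC_left cinner_scaleC_right
          norm_mult norm_divide)
    ultimately show ?thesis
      using False by (simp add: field_simps)
  qed
  with E show ?thesis using that by blast
qed

text \<open>
  Splitting \<open>x\<close> along \<open>E\<close> and then \<open>T\<close> of its residual along \<open>g(E)\<close> writes \<open>T\<close> as an operator of norm
  at most \<open>\<epsilon>\<close> plus an operator of finite rank, so the image of the unit ball is totally bounded.
\<close>

lemma diagonal_sums_bounded_imp_compact:
  assumes "0 < p" "diagonal_sums_bounded p T C" and T: "bounded_clinear T"
  shows "compact_operator T"
proof -
  obtain K where K: "0 < K" "\<And>x. norm (T x) \<le> K * norm x"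
    using bounded_clinear_bound[OF T] by metis
  have near_compact: "\<exists>S. compact S \<and> (\<forall>x \<in> cball 0 1. \<exists>s\<in>S. norm (T x - s) \<le> \<epsilon>)"
    if "0 < \<epsilon>" for \<epsilon>
  proof -
    obtain E g where Eg: "finite E" "orthonormal_family E (\<lambda>e. e)" "orthonormal_family E g"
      and small: "\<And>x y. (\<And>e. e \<in> E \<Longrightarrow> cinner x e = 0) \<Longrightarrow> (\<And>e. e \<in> E \<Longrightarrow> cinner y (g e) = 0) \<Longrightarrow>
       cmod (cinner (T x) y) \<le> \<epsilon> * norm x * norm y"
      using diagonal_sums_bounded_small_off_finite[OF assms(1,2) \<open>0 < \<epsilon>\<close> T] by metis
    obtain S\<^sub>1 where S\<^sub>1: "compact S\<^sub>1"
      "\<And>c. (\<forall>e\<in>E. cmod (c e) \<le> 1) \<Longrightarrow> (\<Sum>e\<in>E. c e *\<^sub>C T e) \<in> S\<^sub>1"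
      using compact_finite_combinations[OF Eg(1), of 1 T] by metis
    obtain S\<^sub>2 where S\<^sub>2: "compact S\<^sub>2"
      "\<And>c. (\<forall>e\<in>E. cmod (c e) \<le> K) \<Longrightarrow> (\<Sum>e\<in>E. c e *\<^sub>C g e) \<in> S\<^sub>2"
      using compact_finite_combinations[OF Eg(1), of K g] by metis
    show ?thesis
    proof (intro exI conjI ballI)
      show "compact {a + b | a b. a \<in> S\<^sub>1 \<and> b \<in> S\<^sub>2}"
        by (rule compact_sums[OF S\<^sub>1(1) S\<^sub>2(1)])
      fix x :: 'a assume "x \<in> cball 0 1"
      then have x: "norm x \<le> 1" by simp
      define y where "y = orthonormal_residual E (\<lambda>e. e) x"
      define z where "z = orthonormal_residual E g (T y)"
      define a where "a = (\<Sum>e\<in>E. cinner x e *\<^sub>C T e)"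
      define b where "b = (\<Sum>e\<in>E. cinner (T y) (g e) *\<^sub>C g e)"
      have y: "norm y \<le> 1"
        using norm_orthonormal_residual_le[OF Eg(1,2), of x] x by (simp add: y_def)
      have "cmod (cinner x e) \<le> 1" if "e \<in> E" for e
        using cinner_Cauchy_Schwarz[of x e] orthonormal_family_norm[OF Eg(2) that] x by simp
      then have "a \<in> S\<^sub>1"
        unfolding a_def by (intro S\<^sub>1) auto
      have "cmod (cinner (T y) (g e)) \<le> K" if "e \<in> E" for e
      proof -
        have "cmod (cinner (T y) (g e)) \<le> norm (T y)"
          using cinner_Cauchy_Schwarz[of "T y" "g e"] orthonormal_family_norm[OF Eg(3) that] by simp
        also have "\<dots> \<le> K * norm y" by (rule K)
        also have "\<dots> \<le> K" using y K(1) by simp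
        finally show ?thesis .
      qed
      then have "b \<in> S\<^sub>2"
        unfolding b_def by (intro S\<^sub>2) auto
      have "T x = T y + a"
        using arg_cong[OF orthonormal_residual_decomp[of x E "\<lambda>e. e"], of T]
        by (simp add: y_def a_def bounded_clinear_add[OF T] bounded_clinear_sum[OF T]
            bounded_clinear_scaleC[OF T])
      moreover have "T y = z + b"
        unfolding z_def b_def by (rule orthonormal_residual_decomp)
      ultimately have "T x - (a + b) = z" by simp
      have "cmod (cinner (T y) z) \<le> \<epsilon> * norm y * norm z"
        unfolding y_def z_def
        by (rule small) (intro cinner_orthonormal_residual[OF Eg(1,2)] cinner_orthonormal_residual[OF Eg(1,3)]; assumption)+
      then have "norm z * norm z \<le> \<epsilon> * norm y * norm z"
        unfolding z_def cinner_orthonormal_residual_self[OF Eg(1,3)]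
        by (simp add: norm_power power2_eq_square norm_mult)
      moreover have "0 \<le> \<epsilon> * norm y" using that by simp
      ultimately have "norm z \<le> \<epsilon> * norm y"
        by (cases "z = 0") auto
      also have "\<dots> \<le> \<epsilon>" using y that by simp
      finally have "norm (T x - (a + b)) \<le> \<epsilon>" using \<open>T x - (a + b) = z\<close> by simp
      then show "\<exists>s\<in>{a + b | a b. a \<in> S\<^sub>1 \<and> b \<in> S\<^sub>2}. norm (T x - s) \<le> \<epsilon>"
        using \<open>a \<in> S\<^sub>1\<close> \<open>b \<in> S\<^sub>2\<close> by blast
    qed
  qed
  have "\<exists>k. finite k \<and> closure (T ` cball 0 1) \<subseteq> (\<Union>x\<in>k. ball x \<epsilon>)" if "0 < \<epsilon>" for \<epsilon>
  proof -
    have "0 < \<epsilon> / 4" using that by simp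
    from near_compact[OF this]
    obtain S where S: "compact S" "\<forall>x \<in> cball 0 1. \<exists>s\<in>S. norm (T x - s) \<le> \<epsilon> / 4"
      by blast
    obtain k where k: "finite k" "S \<subseteq> (\<Union>x\<in>k. ball x (\<epsilon> / 4))"
      using compact_eq_totally_bounded[THEN iffD1, THEN conjunct2, rule_format, OF S(1) \<open>0 < \<epsilon> / 4\<close>]
      by blast
    have "T ` cball 0 1 \<subseteq> (\<Union>x\<in>k. cball x (\<epsilon> / 2))"
    proof clarify
      fix x :: 'a assume "x \<in> cball 0 1"
      then obtain s where s: "s \<in> S" "norm (T x - s) \<le> \<epsilon> / 4" using S(2) by blast
      then obtain c where c: "c \<in> k" "dist c s < \<epsilon> / 4" using k(2) by auto
      have "dist c (T x) \<le> dist c s + dist s (T x)" by (rule dist_triangle)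
      also have "\<dots> \<le> \<epsilon> / 2" using s c by (simp add: dist_norm norm_minus_commute)
      finally show "T x \<in> (\<Union>x\<in>k. cball x (\<epsilon> / 2))" using c by auto
    qed
    then have "closure (T ` cball 0 1) \<subseteq> (\<Union>x\<in>k. cball x (\<epsilon> / 2))"
      using k(1) by (intro closure_minimal closed_UN) auto
    also have "\<dots> \<subseteq> (\<Union>x\<in>k. ball x \<epsilon>)"
      using that by (intro UN_mono) auto
    finally show ?thesis using k(1) by blast
  qed
  moreover have "complete (closure (T ` cball 0 1))"
    by (simp add: complete_eq_closed)
  ultimately have "compact (closure (T ` cball 0 1))"
    unfolding compact_eq_totally_bounded by blast
  with T show ?thesis
    by (simp add: compact_operator_def)
qed

text \<open>Eigenspaces are subspaces, so Gram--Schmidt applied to a basis does not leave them. If the eigenspace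
  had infinite dimension, \<open>sv_mult\<close> would be \<open>0\<close> and the empty set has the required cardinality.\<close>

lemma orthonormal_subset_of_eigenspace:
  assumes T: "bounded_clinear T"
  obtains E where "finite E" "E \<subseteq> sv_eigenspace T s" "card E = sv_mult T s"
    "orthonormal_family E (\<lambda>e. e)"
proof -
  have ex: "\<exists>E. finite E \<and> E \<subseteq> sv_eigenspace T s \<and> card E = sv_mult T s \<and> orthonormal_family E (\<lambda>e. e)"
  proof -
    obtain B where B: "B \<subseteq> sv_eigenspace T s" "complex_vs.independent B" "card B = sv_mult T s"
      unfolding sv_mult_def using complex_vs.basis_exists by metis
    show ?thesis
    proof (cases "finite B")
      case True
      then obtain E where E: "finite E" "card E = card B" "E \<subseteq> complex_vs.span B"
        "orthonormal_family E (\<lambda>x. x)"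
        using independent_imp_orthonormal B(2) by metis
      have adj_add: "cadjoint T (x + y) = cadjoint T x + cadjoint T y" for x y
        by (intro cinner_eqI)
           (metis cinner_add_left cinner_add_right cinner_cadjoint[OF T] cinner_commute)
      have adj_scale: "cadjoint T (c *\<^sub>C x) = c *\<^sub>C cadjoint T x" for c x
        by (intro cinner_eqI)
           (metis cinner_scaleC_left cinner_scaleC_right cinner_cadjoint[OF T] cinner_commute)
      have "complex_vs.subspace (sv_eigenspace T s)"
        unfolding complex_vs.subspace_def sv_eigenspace_def
        using bounded_clinear_scaleC[OF T, of 0 0] adj_scale[of 0 0]
        by (auto simp: adj_add adj_scale bounded_clinear_add[OF T] bounded_clinear_scaleC[OF T]
            scaleC_add_right scaleC_scaleC mult.commute)
      then have "complex_vs.span B \<subseteq> sv_eigenspace T s"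
        using B(1) by (rule complex_vs.span_minimal[rotated])
      with E B show ?thesis by (metis subset_trans)
    next
      case False
      with B(3) show ?thesis
        by (intro exI[of _ "{}"]) (auto simp: orthonormal_family_def)
    qed
  qed
  then show ?thesis using that by blast
qed

text \<open>
  Eigenvectors of \<open>T\<^sup>*T\<close> to different eigenvalues are orthogonal, so orthonormal bases of the eigenspaces
  combine to one orthonormal family. On it \<open>\<langle>T x, T y\<rangle> = s\<^sup>2 \<langle>x, y\<rangle>\<close>, so the vectors \<open>T e / s\<close> are
  orthonormal too, and the diagonal entry \<open>\<langle>T e, T e / s\<rangle>\<close> is the singular value \<open>s\<close>.
\<close>

lemma diagonal_sums_bounded_singular_values:
  assumes "diagonal_sums_bounded p T C" and T: "bounded_clinear T"
    and S: "finite S" "S \<subseteq> singular_values T"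
  shows "(\<Sum>s\<in>S. real (sv_mult T s) * s powr p) \<le> C"
proof -
  have "\<forall>s. \<exists>E. finite E \<and> E \<subseteq> sv_eigenspace T s \<and> card E = sv_mult T s \<and>
      orthonormal_family E (\<lambda>e. e)"
    using orthonormal_subset_of_eigenspace[OF T] by metis
  then obtain E where E: "\<And>s. finite (E s)" "\<And>s. E s \<subseteq> sv_eigenspace T s"
    "\<And>s. card (E s) = sv_mult T s" "\<And>s. orthonormal_family (E s) (\<lambda>e. e)" by metis
  have pos: "0 < s" if "s \<in> S" for s
    using that S(2) by (auto simp: singular_values_def)
  have TT: "cinner (T x) (T y) = (complex_of_real s)\<^sup>2 * cinner x y" if "y \<in> E s" for x y s
    using that E(2)[of s]
    by (auto simp: cinner_cadjoint[OF T] sv_eigenspace_def cinner_scaleC_right)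
  have orth: "cinner x y = 0" if "x \<in> E s" "y \<in> E t" "s \<in> S" "t \<in> S" "s \<noteq> t" for x y s t
  proof -
    have "cinner (T y) (T x) = (complex_of_real s)\<^sup>2 * cinner y x"
      using TT[OF that(1)] .
    then have "cnj (cinner (T y) (T x)) = (complex_of_real s)\<^sup>2 * cnj (cinner y x)"
      by simp
    then have "(complex_of_real t)\<^sup>2 * cinner x y = (complex_of_real s)\<^sup>2 * cinner x y"
      unfolding cinner_commute[symmetric] TT[OF that(2)] .
    moreover have "t\<^sup>2 \<noteq> s\<^sup>2"
      using pos[OF that(3)] pos[OF that(4)] that(5) by (simp add: power2_eq_iff)
    then have "(complex_of_real t)\<^sup>2 \<noteq> (complex_of_real s)\<^sup>2"
      by (metis of_real_eq_iff of_real_power)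
    ultimately show ?thesis by simp
  qed
  have norm1: "norm e = 1" if "e \<in> E s" for e s
    using orthonormal_family_norm[OF E(4) that] .
  have disj: "E s \<inter> E t = {}" if "s \<in> S" "t \<in> S" "s \<noteq> t" for s t
  proof (rule ccontr)
    assume "E s \<inter> E t \<noteq> {}"
    then obtain e where "e \<in> E s" "e \<in> E t" by blast
    with orth[OF this that] norm1 show False by (auto simp: cinner_self)
  qed
  define D where "D = (\<Union>s\<in>S. E s)"
  define \<sigma> where "\<sigma> e = norm (T e)" for e
  have \<sigma>: "\<sigma> e = s" if "e \<in> E s" "s \<in> S" for e s
  proof -
    have "(\<sigma> e)\<^sup>2 = s\<^sup>2"
      using TT[OF that(1), of e] norm1[OF that(1)]
      by (simp add: \<sigma>_def cinner_self flip: of_real_power)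
    then show ?thesis using pos[OF that(2)] by (simp add: \<sigma>_def)
  qed
  define g where "g e = complex_of_real (1 / \<sigma> e) *\<^sub>C T e" for e
  have D: "finite D" using S(1) E(1) by (simp add: D_def)
  have onD: "orthonormal_family D (\<lambda>e. e)"
    unfolding orthonormal_family_def
  proof (intro ballI)
    fix x y assume "x \<in> D" "y \<in> D"
    then obtain s t where st: "x \<in> E s" "s \<in> S" "y \<in> E t" "t \<in> S" by (auto simp: D_def)
    show "cinner x y = (if x = y then 1 else 0)"
    proof (cases "s = t")
      case True
      with st E(4)[of s] show ?thesis by (auto simp: orthonormal_family_def)
    next
      case False
      with st orth disj[OF st(2,4)] show ?thesis by auto
    qed
  qed
  have ong: "orthonormal_family D g"
    unfolding orthonormal_family_def
  proof (intro ballI)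
    fix x y assume xy: "x \<in> D" "y \<in> D"
    then obtain t where t: "y \<in> E t" "t \<in> S" by (auto simp: D_def)
    have "cinner (g x) (g y) = cinner (T x) (T y) / (\<sigma> x * \<sigma> y)"
      by (simp add: g_def cinner_scaleC_left cinner_scaleC_right)
    also have "\<dots> = t\<^sup>2 * cinner x y / (\<sigma> x * t)"
      using TT[OF t(1)] \<sigma>[OF t] by simp
    also have "\<dots> = (if x = y then 1 else 0)"
      using onD xy pos[OF t(2)] \<sigma>[OF t] by (auto simp: orthonormal_family_def power2_eq_square)
    finally show "cinner (g x) (g y) = (if x = y then 1 else 0)" .
  qed
  have "(\<Sum>s\<in>S. real (sv_mult T s) * s powr p) = (\<Sum>s\<in>S. \<Sum>e\<in>E s. \<sigma> e powr p)"
  proof (intro sum.cong refl)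
    fix s assume "s \<in> S"
    then have "(\<Sum>e\<in>E s. \<sigma> e powr p) = (\<Sum>e\<in>E s. s powr p)"
      by (intro sum.cong) (auto simp: \<sigma>)
    then show "real (sv_mult T s) * s powr p = (\<Sum>e\<in>E s. \<sigma> e powr p)"
      by (simp add: E(3))
  qed
  also have "\<dots> = (\<Sum>e\<in>D. \<sigma> e powr p)"
    unfolding D_def using S(1) E(1) disj by (intro sum.UNION_disjoint[symmetric]) auto
  also have "\<dots> = (\<Sum>e\<in>D. cmod (cinner (T e) (g e)) powr p)"
  proof (intro sum.cong refl)
    fix e assume "e \<in> D"
    have "cmod (cinner (T e) (g e)) = \<sigma> e"
      by (simp add: g_def cinner_scaleC_right cinner_self norm_divide norm_power \<sigma>_def power2_eq_square norm_mult)
    then show "\<sigma> e powr p = cmod (cinner (T e) (g e)) powr p" by simp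
  qed
  also have "\<dots> \<le> C"
    using assms(1) D onD ong by (auto simp: diagonal_sums_bounded_def)
  finally show ?thesis .
qed

theorem diagonal_sums_bounded_imp_schatten:
  assumes "0 < p" "diagonal_sums_bounded p T C" "bounded_clinear T"
  shows "T \<in> schatten_class p" "schatten_norm p T \<le> C powr (1 / p)"
proof -
  let ?f = "\<lambda>s. real (sv_mult T s) * s powr p"
  have sums: "sum ?f S \<le> C" if "finite S" "S \<subseteq> singular_values T" for S
    using diagonal_sums_bounded_singular_values[OF assms(2,3) that] .
  have summable: "?f summable_on singular_values T"
    by (rule nonneg_bounded_partial_sums_imp_summable_on[of _ _ C])
       (auto intro!: sums)
  then show "T \<in> schatten_class p"
    using diagonal_sums_bounded_imp_compact[OF assms] by (simp add: schatten_class_def)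
  show "schatten_norm p T \<le> C powr (1 / p)"
    unfolding schatten_norm_def using assms(1) summable sums
    by (intro powr_mono2 infsum_le_finite_sums infsum_nonneg) auto
qed

section \<open>Hoelder's inequality\<close>

lemma Youngs_inequality_powr:
  fixes x y :: real
  assumes "0 < \<alpha>" "0 < \<beta>" "\<alpha> + \<beta> = 1" "0 \<le> x" "0 \<le> y"
  shows "x powr \<alpha> * y powr \<beta> \<le> \<alpha> * x + \<beta> * y"
proof (cases "x = 0 \<or> y = 0")
  case False
  with assms show ?thesis by (intro Youngs_inequality_0) auto
qed (use assms in auto)

text \<open>Hoelder's inequality is used in the form \<open>\<integral> X\<^sup>\<alpha> Y\<^sup>\<beta> \<le> (\<integral> X)\<^sup>\<alpha> (\<integral> Y)\<^sup>\<beta>\<close> with \<open>\<alpha> + \<beta> = 1\<close>, which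
  covers both the Cauchy--Schwarz inequality and the weighted estimate for the multiplier.\<close>

lemma integrable_powr_mult_powr:
  fixes X Y :: "'w \<Rightarrow> real"
  assumes ab: "0 < \<alpha>" "0 < \<beta>" "\<alpha> + \<beta> = 1"
    and [simp]: "integrable M X" "integrable M Y"
    and nonneg: "\<And>\<omega>. 0 \<le> X \<omega>" "\<And>\<omega>. 0 \<le> Y \<omega>"
  shows "integrable M (\<lambda>\<omega>. X \<omega> powr \<alpha> * Y \<omega> powr \<beta>)"
proof (rule Bochner_Integration.integrable_bound)
  show "integrable M (\<lambda>\<omega>. \<alpha> * X \<omega> + \<beta> * Y \<omega>)" by simp
  have [measurable]: "X \<in> borel_measurable M" "Y \<in> borel_measurable M"
    by (auto intro: borel_measurable_integrable)
  show "(\<lambda>\<omega>. X \<omega> powr \<alpha> * Y \<omega> powr \<beta>) \<in> borel_measurable M" by measurable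
  show "AE \<omega> in M. norm (X \<omega> powr \<alpha> * Y \<omega> powr \<beta>) \<le> norm (\<alpha> * X \<omega> + \<beta> * Y \<omega>)"
    using Youngs_inequality_powr[OF ab nonneg] ab nonneg by (intro AE_I2) (simp add: abs_mult)
qed

text \<open>Integrate Young's inequality for \<open>X\<close> and \<open>Y\<close> normalised to have integral \<open>1\<close>. If one of the
  integrals vanishes, so does the product almost everywhere.\<close>

lemma Holder_inequality_powr:
  fixes X Y :: "'w \<Rightarrow> real"
  assumes ab: "0 < \<alpha>" "0 < \<beta>" "\<alpha> + \<beta> = 1"
    and int: "integrable M X" "integrable M Y"
    and nonneg: "\<And>\<omega>. 0 \<le> X \<omega>" "\<And>\<omega>. 0 \<le> Y \<omega>"
  shows "(LINT \<omega>|M. X \<omega> powr \<alpha> * Y \<omega> powr \<beta>) \<le> (LINT \<omega>|M. X \<omega>) powr \<alpha> * (LINT \<omega>|M. Y \<omega>) powr \<beta>"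
proof (cases "(LINT \<omega>|M. X \<omega>) = 0 \<or> (LINT \<omega>|M. Y \<omega>) = 0")
  case True
  then have "(AE \<omega> in M. X \<omega> = 0) \<or> (AE \<omega> in M. Y \<omega> = 0)"
    using integral_nonneg_eq_0_iff_AE[OF int(1)] integral_nonneg_eq_0_iff_AE[OF int(2)] nonneg by auto
  then have "AE \<omega> in M. X \<omega> powr \<alpha> * Y \<omega> powr \<beta> = 0"
    by (auto elim: eventually_mono)
  then have "(LINT \<omega>|M. X \<omega> powr \<alpha> * Y \<omega> powr \<beta>) = 0"
    by (rule integral_eq_zero_AE)
  then show ?thesis by simp
next
  case False
  define A where "A = (LINT \<omega>|M. X \<omega>)"
  define B where "B = (LINT \<omega>|M. Y \<omega>)"
  have pos: "0 < A" "0 < B"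
    using False nonneg by (auto simp: A_def B_def less_le intro!: integral_nonneg_AE)
  have "(LINT \<omega>|M. (X \<omega> powr \<alpha> * Y \<omega> powr \<beta>) / (A powr \<alpha> * B powr \<beta>))
      \<le> (LINT \<omega>|M. \<alpha> * (X \<omega> / A) + \<beta> * (Y \<omega> / B))"
  proof (rule integral_mono)
    show "integrable M (\<lambda>\<omega>. (X \<omega> powr \<alpha> * Y \<omega> powr \<beta>) / (A powr \<alpha> * B powr \<beta>))"
      using integrable_powr_mult_powr[OF ab int nonneg] by simp
    show "integrable M (\<lambda>\<omega>. \<alpha> * (X \<omega> / A) + \<beta> * (Y \<omega> / B))"
      using int by simp
    fix \<omega>
    show "(X \<omega> powr \<alpha> * Y \<omega> powr \<beta>) / (A powr \<alpha> * B powr \<beta>) \<le> \<alpha> * (X \<omega> / A) + \<beta> * (Y \<omega> / B)"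
      using Youngs_inequality_powr[OF ab, of "X \<omega> / A" "Y \<omega> / B"] pos nonneg[of \<omega>]
      by (simp add: powr_divide)
  qed
  also have "\<dots> = 1"
    using int pos ab by (simp add: A_def[symmetric] B_def[symmetric])
  finally show ?thesis
    using pos by (simp add: A_def[symmetric] B_def[symmetric] field_simps)
qed

section \<open>Continuous Bessel multipliers\<close>

context
  fixes M :: "'w measure"
    and F G :: "'w \<Rightarrow> 'a::complex_hilbert"
    and m :: "'w \<Rightarrow> complex"
    and p q L\<^sub>F L\<^sub>G B\<^sub>F B\<^sub>G :: real
  assumes F: "bessel_mapping M F B\<^sub>F" and G: "bessel_mapping M G B\<^sub>G"
    and bdd_F: "norm_bounded_mapping M F L\<^sub>F" and bdd_G: "norm_bounded_mapping M G L\<^sub>G"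
    and p: "1 < p" and pq: "1 / p + 1 / q = 1"
    and m: "in_Lp p M m"
begin

lemma conjugate_exponents: "0 < 1 / p" "0 < 1 / q"
proof -
  have "1 / p < 1" using p by simp
  then show "0 < 1 / q" using pq by linarith
qed (use p in simp)

lemma measurable_multiplier [measurable]:
  "m \<in> borel_measurable M"
  "(\<lambda>\<omega>. cinner f (F \<omega>)) \<in> borel_measurable M"
  "(\<lambda>\<omega>. cinner (G \<omega>) g) \<in> borel_measurable M"
proof -
  have [measurable]: "(\<lambda>\<omega>. cinner g (G \<omega>)) \<in> borel_measurable M"
    using G by (auto simp: bessel_mapping_def)
  have "(\<lambda>\<omega>. cnj (cinner g (G \<omega>))) \<in> borel_measurable M"
    by (rule borel_measurable_continuous_on[of cnj]) (intro continuous_intros, measurable)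
  then show "(\<lambda>\<omega>. cinner (G \<omega>) g) \<in> borel_measurable M"
    by (simp flip: cinner_commute)
qed (use F m in \<open>auto simp: bessel_mapping_def in_Lp_def\<close>)

definition coeff_product :: "'a \<Rightarrow> 'a \<Rightarrow> 'w \<Rightarrow> real" where
  "coeff_product f g \<omega> = cmod (cinner f (F \<omega>)) * cmod (cinner (G \<omega>) g)"

lemma coeff_product_nonneg: "0 \<le> coeff_product f g \<omega>"
  by (simp add: coeff_product_def)

lemma measurable_coeff_product [measurable]: "coeff_product f g \<in> borel_measurable M"
  unfolding coeff_product_def by measurable

text \<open>The absolute value makes the right-hand side nonnegative even if \<open>M\<close> is trivial and the bounds
  negative. It disappears in the final estimate, because \<open>powr\<close> is an even function of its base.\<close>

lemma AE_norm_mult_le: "AE \<omega> in M. norm (F \<omega>) * norm (G \<omega>) \<le> \<bar>L\<^sub>F * L\<^sub>G\<bar>"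
  using bdd_F bdd_G unfolding norm_bounded_mapping_def
proof eventually_elim
  case (elim \<omega>)
  then have "norm (F \<omega>) * norm (G \<omega>) \<le> L\<^sub>F * L\<^sub>G"
    by (intro mult_mono) (auto intro: order_trans[OF norm_ge_zero])
  then show ?case by simp
qed

lemma square_integrals:
  "integrable M (\<lambda>\<omega>. (cmod (cinner f (F \<omega>)))\<^sup>2)"
  "(LINT \<omega>|M. (cmod (cinner f (F \<omega>)))\<^sup>2) \<le> B\<^sub>F * (norm f)\<^sup>2"
  "integrable M (\<lambda>\<omega>. (cmod (cinner (G \<omega>) g))\<^sup>2)"
  "(LINT \<omega>|M. (cmod (cinner (G \<omega>) g))\<^sup>2) \<le> B\<^sub>G * (norm g)\<^sup>2"
  using F G by (auto simp: bessel_mapping_def cmod_cinner_commute[of _ g])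

lemma coeff_product_eq_powr:
  "coeff_product f g \<omega> = ((cmod (cinner f (F \<omega>)))\<^sup>2) powr (1/2) * ((cmod (cinner (G \<omega>) g))\<^sup>2) powr (1/2)"
  by (simp add: coeff_product_def powr_half_sqrt)

lemma integrable_coeff_product: "integrable M (coeff_product f g)"
  unfolding coeff_product_eq_powr
  by (rule integrable_powr_mult_powr) (auto intro: square_integrals)

lemma integral_coeff_product_le:
  "(LINT \<omega>|M. coeff_product f g \<omega>) \<le> (B\<^sub>F * B\<^sub>G) powr (1/2) * (norm f * norm g)"
proof -
  have "(LINT \<omega>|M. coeff_product f g \<omega>) \<le> (LINT \<omega>|M. (cmod (cinner f (F \<omega>)))\<^sup>2) powr (1/2) *
      (LINT \<omega>|M. (cmod (cinner (G \<omega>) g))\<^sup>2) powr (1/2)"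
    unfolding coeff_product_eq_powr by (rule Holder_inequality_powr) (auto intro: square_integrals)
  also have "\<dots> \<le> (B\<^sub>F * (norm f)\<^sup>2) powr (1/2) * (B\<^sub>G * (norm g)\<^sup>2) powr (1/2)"
    by (intro mult_mono powr_mono2 square_integrals) auto
  also have "\<dots> = (B\<^sub>F * B\<^sub>G) powr (1/2) * (norm f * norm g)"
    by (simp add: powr_mult powr_half_sqrt)
  finally show ?thesis .
qed

lemma sum_coeff_product_le:
  assumes "finite E" "orthonormal_family E e" "orthonormal_family E g"
  shows "AE \<omega> in M. (\<Sum>i\<in>E. coeff_product (e i) (g i) \<omega>) \<le> \<bar>L\<^sub>F * L\<^sub>G\<bar>"
  using AE_norm_mult_le
proof eventually_elim
  case (elim \<omega>)
  have "(\<Sum>i\<in>E. coeff_product (e i) (g i) \<omega>) \<le> norm (F \<omega>) * norm (G \<omega>)"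
    using orthonormal_Bessel_product[OF assms, of "F \<omega>" "G \<omega>"]
    by (simp add: coeff_product_def cmod_cinner_commute[of _ "F \<omega>"])
  with elim show ?case by linarith
qed

lemma coeff_product_le: "AE \<omega> in M. coeff_product f g \<omega> \<le> \<bar>L\<^sub>F * L\<^sub>G\<bar> * (norm f * norm g)"
  using AE_norm_mult_le
proof eventually_elim
  case (elim \<omega>)
  have "coeff_product f g \<omega> \<le> (norm f * norm (F \<omega>)) * (norm (G \<omega>) * norm g)"
    unfolding coeff_product_def by (intro mult_mono cinner_Cauchy_Schwarz) auto
  also have "\<dots> = (norm (F \<omega>) * norm (G \<omega>)) * (norm f * norm g)"
    by (simp add: mult_ac)
  also have "\<dots> \<le> \<bar>L\<^sub>F * L\<^sub>G\<bar> * (norm f * norm g)"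
    by (intro mult_right_mono elim) auto
  finally show ?case .
qed

lemma integrable_symbol: "integrable M (\<lambda>\<omega>. cmod (m \<omega>) powr p)"
  using m by (simp add: in_Lp_def)

lemma integrable_symbol_coeff_product: "integrable M (\<lambda>\<omega>. cmod (m \<omega>) powr p * coeff_product f g \<omega>)"
proof (rule Bochner_Integration.integrable_bound)
  show "integrable M (\<lambda>\<omega>. cmod (m \<omega>) powr p * (\<bar>L\<^sub>F * L\<^sub>G\<bar> * (norm f * norm g)))"
    using integrable_symbol by simp
  show "AE \<omega> in M. norm (cmod (m \<omega>) powr p * coeff_product f g \<omega>)
      \<le> norm (cmod (m \<omega>) powr p * (\<bar>L\<^sub>F * L\<^sub>G\<bar> * (norm f * norm g)))"
    using coeff_product_le[of f g]
  proof eventually_elim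
    case (elim \<omega>)
    then have "cmod (m \<omega>) powr p * coeff_product f g \<omega>
        \<le> cmod (m \<omega>) powr p * (\<bar>L\<^sub>F * L\<^sub>G\<bar> * (norm f * norm g))"
      by (intro mult_left_mono) auto
    then show ?case
      using coeff_product_nonneg[of f g \<omega>] by (simp add: abs_mult)
  qed
qed measurable

lemma integral_symbol_coeff_product_nonneg: "0 \<le> (LINT \<omega>|M. cmod (m \<omega>) powr p * coeff_product f g \<omega>)"
  by (intro integral_nonneg_AE AE_I2) (simp add: coeff_product_nonneg)

lemma integral_symbol_coeff_product_le:
  "(LINT \<omega>|M. cmod (m \<omega>) powr p * coeff_product f g \<omega>)
    \<le> (LINT \<omega>|M. cmod (m \<omega>) powr p) * \<bar>L\<^sub>F * L\<^sub>G\<bar> * (norm f * norm g)"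
proof -
  have "(LINT \<omega>|M. cmod (m \<omega>) powr p * coeff_product f g \<omega>)
      \<le> (LINT \<omega>|M. cmod (m \<omega>) powr p * (\<bar>L\<^sub>F * L\<^sub>G\<bar> * (norm f * norm g)))"
    using integrable_symbol integrable_symbol_coeff_product coeff_product_le[of f g]
    by (intro integral_mono_AE) (auto elim!: eventually_mono intro!: mult_left_mono)
  then show ?thesis by (simp add: mult.assoc)
qed

lemma sum_integral_symbol_coeff_product_le:
  assumes "finite E" "orthonormal_family E e" "orthonormal_family E g"
  shows "(\<Sum>i\<in>E. LINT \<omega>|M. cmod (m \<omega>) powr p * coeff_product (e i) (g i) \<omega>)
    \<le> (LINT \<omega>|M. cmod (m \<omega>) powr p) * \<bar>L\<^sub>F * L\<^sub>G\<bar>"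
proof -
  let ?c = "\<lambda>\<omega>. cmod (m \<omega>) powr p"
  have int: "integrable M (\<lambda>\<omega>. ?c \<omega> * (\<Sum>i\<in>E. coeff_product (e i) (g i) \<omega>))"
    unfolding sum_distrib_left by (intro Bochner_Integration.integrable_sum integrable_symbol_coeff_product)
  have "(\<Sum>i\<in>E. LINT \<omega>|M. ?c \<omega> * coeff_product (e i) (g i) \<omega>)
      = (LINT \<omega>|M. ?c \<omega> * (\<Sum>i\<in>E. coeff_product (e i) (g i) \<omega>))"
    unfolding sum_distrib_left
    by (rule Bochner_Integration.integral_sum[symmetric]) (rule integrable_symbol_coeff_product)
  also have "\<dots> \<le> (LINT \<omega>|M. ?c \<omega> * \<bar>L\<^sub>F * L\<^sub>G\<bar>)"
  proof (rule integral_mono_AE[OF int])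
    show "AE \<omega> in M. ?c \<omega> * (\<Sum>i\<in>E. coeff_product (e i) (g i) \<omega>) \<le> ?c \<omega> * \<bar>L\<^sub>F * L\<^sub>G\<bar>"
      using sum_coeff_product_le[OF assms] by (auto elim!: eventually_mono intro!: mult_left_mono)
  qed (use integrable_symbol in simp)
  finally show ?thesis by simp
qed

text \<open>The factorisation to which Hoelder's inequality is applied: \<open>1 / p + 1 / q = 1\<close> recombines the two
  powers of the coefficient product.\<close>

lemma cmod_multiplier_integrand:
  "cmod (multiplier_integrand m F G f g \<omega>)
    = (cmod (m \<omega>) powr p * coeff_product f g \<omega>) powr (1 / p) * coeff_product f g \<omega> powr (1 / q)"
proof -
  have "(cmod (m \<omega>) powr p * coeff_product f g \<omega>) powr (1 / p) * coeff_product f g \<omega> powr (1 / q)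
      = cmod (m \<omega>) * coeff_product f g \<omega> powr (1 / p + 1 / q)"
    using p by (simp add: powr_mult powr_powr powr_add)
  then show ?thesis
    by (simp add: pq coeff_product_nonneg) (simp add: coeff_product_def multiplier_integrand_def norm_mult)
qed

lemma integrable_multiplier_integrand: "integrable M (multiplier_integrand m F G f g)"
proof -
  have "(\<lambda>\<omega>. multiplier_integrand m F G f g \<omega>) \<in> borel_measurable M"
    unfolding multiplier_integrand_def by measurable
  moreover have "integrable M (\<lambda>\<omega>. norm (multiplier_integrand m F G f g \<omega>))"
    unfolding cmod_multiplier_integrand
    by (rule integrable_powr_mult_powr[OF conjugate_exponents pq])
       (auto simp: coeff_product_nonneg integrable_symbol_coeff_product integrable_coeff_product)
  ultimately show ?thesis
    by (simp add: integrable_norm_iff)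
qed

definition multiplier_form :: "'a \<Rightarrow> 'a \<Rightarrow> complex" where
  "multiplier_form f g = (LINT \<omega>|M. multiplier_integrand m F G f g \<omega>)"

lemma cmod_multiplier_form_le:
  "cmod (multiplier_form f g) \<le> (LINT \<omega>|M. cmod (m \<omega>) powr p * coeff_product f g \<omega>) powr (1 / p) *
     ((B\<^sub>F * B\<^sub>G) powr (1/2) * (norm f * norm g)) powr (1 / q)"
proof -
  have "cmod (multiplier_form f g) \<le> (LINT \<omega>|M. cmod (multiplier_integrand m F G f g \<omega>))"
    unfolding multiplier_form_def by (rule integral_norm_bound)
  also have "\<dots> \<le> (LINT \<omega>|M. cmod (m \<omega>) powr p * coeff_product f g \<omega>) powr (1 / p) *
      (LINT \<omega>|M. coeff_product f g \<omega>) powr (1 / q)"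
    unfolding cmod_multiplier_integrand
    by (rule Holder_inequality_powr[OF conjugate_exponents pq])
       (auto simp: coeff_product_nonneg integrable_symbol_coeff_product integrable_coeff_product)
  also have "\<dots> \<le> (LINT \<omega>|M. cmod (m \<omega>) powr p * coeff_product f g \<omega>) powr (1 / p) *
     ((B\<^sub>F * B\<^sub>G) powr (1/2) * (norm f * norm g)) powr (1 / q)"
    using conjugate_exponents
    by (intro mult_left_mono powr_mono2 integral_coeff_product_le integral_nonneg_AE)
       (auto simp: coeff_product_nonneg)
  finally show ?thesis .
qed

text \<open>Both factors of the Hoelder estimate are homogeneous in \<open>\<parallel>f\<parallel> \<parallel>g\<parallel>\<close>, of total degree
  \<open>1 / p + 1 / q = 1\<close>.\<close>

lemma multiplier_form_bounded:
  "cmod (multiplier_form f g) \<le>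
    (((LINT \<omega>|M. cmod (m \<omega>) powr p) * \<bar>L\<^sub>F * L\<^sub>G\<bar>) powr (1 / p) * ((B\<^sub>F * B\<^sub>G) powr (1/2)) powr (1 / q))
      * norm f * norm g"
proof -
  define N where "N = norm f * norm g"
  define W where "W = (LINT \<omega>|M. cmod (m \<omega>) powr p) * \<bar>L\<^sub>F * L\<^sub>G\<bar>"
  define D where "D = (B\<^sub>F * B\<^sub>G) powr (1/2)"
  have "cmod (multiplier_form f g)
      \<le> (LINT \<omega>|M. cmod (m \<omega>) powr p * coeff_product f g \<omega>) powr (1 / p) * (D * N) powr (1 / q)"
    unfolding D_def N_def by (rule cmod_multiplier_form_le)
  also have "\<dots> \<le> (W * N) powr (1 / p) * (D * N) powr (1 / q)"
    using integral_symbol_coeff_product_le[of f g] integral_symbol_coeff_product_nonneg[of f g] p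
    by (intro mult_right_mono powr_mono2) (auto simp: W_def N_def)
  also have "\<dots> = (W powr (1 / p) * D powr (1 / q)) * N powr (1 / p + 1 / q)"
    by (simp add: powr_mult powr_add)
  also have "\<dots> = (W powr (1 / p) * D powr (1 / q)) * N"
    by (simp add: pq N_def)
  finally show ?thesis
    by (simp add: W_def N_def D_def mult.assoc)
qed

lemma multiplier_operator:
  obtains T where "bounded_clinear T" "is_multiplier M m F G T"
proof -
  note int = integrable_multiplier_integrand
  have add_left: "multiplier_form (f + g) h = multiplier_form f h + multiplier_form g h" for f g h
    unfolding multiplier_form_def Bochner_Integration.integral_add[OF int int, symmetric]
    by (simp add: multiplier_integrand_def[abs_def] cinner_add_left algebra_simps)
  have add_right: "multiplier_form f (g + h) = multiplier_form f g + multiplier_form f h" for f g h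
    unfolding multiplier_form_def Bochner_Integration.integral_add[OF int int, symmetric]
    by (simp add: multiplier_integrand_def[abs_def] cinner_add_right algebra_simps)
  have scale_left: "multiplier_form (c *\<^sub>C f) g = c * multiplier_form f g" for c f g
    unfolding multiplier_form_def integral_mult_right_zero[symmetric]
    by (simp add: multiplier_integrand_def[abs_def] cinner_scaleC_left mult_ac)
  have scale_right: "multiplier_form f (c *\<^sub>C g) = cnj c * multiplier_form f g" for c f g
    unfolding multiplier_form_def integral_mult_right_zero[symmetric]
    by (simp add: multiplier_integrand_def[abs_def] cinner_scaleC_right mult_ac)
  obtain T where "bounded_clinear T" "\<And>f g. cinner (T f) g = multiplier_form f g"
    using bounded_sesquilinear_form_operator[of multiplier_form, OF add_left add_right scale_left
        scale_right multiplier_form_bounded] by blast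
  then show ?thesis
    using that by (simp add: is_multiplier_def multiplier_form_def)
qed

lemma is_multiplier_unique:
  assumes "is_multiplier M m F G S" "is_multiplier M m F G T"
  shows "S = T"
proof
  fix f show "S f = T f"
    using assms by (intro cinner_eqI) (simp add: is_multiplier_def)
qed

text \<open>The second Hoelder factor is bounded uniformly over unit vectors, and the \<open>p\<close>-th power of the first
  is an integral that is linear in the coefficient product. The sum therefore moves under the integral, where
  Bessel's inequality bounds it pointwise.\<close>

lemma is_multiplier_diagonal_sums_bounded:
  assumes "is_multiplier M m F G T"
  shows "diagonal_sums_bounded p T
    ((LINT \<omega>|M. cmod (m \<omega>) powr p) * \<bar>L\<^sub>F * L\<^sub>G\<bar> * ((B\<^sub>F * B\<^sub>G) powr (1 / (2 * q))) powr p)"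
  unfolding diagonal_sums_bounded_def
proof (intro allI impI)
  fix E and g :: "'a \<Rightarrow> 'a"
  assume E: "finite E" "orthonormal_family E (\<lambda>e. e)" "orthonormal_family E g"
  define D where "D = (B\<^sub>F * B\<^sub>G) powr (1 / (2 * q))"
  let ?A = "\<lambda>e. LINT \<omega>|M. cmod (m \<omega>) powr p * coeff_product e (g e) \<omega>"
  have "(\<Sum>e\<in>E. cmod (cinner (T e) (g e)) powr p) \<le> (\<Sum>e\<in>E. ?A e * D powr p)"
  proof (rule sum_mono)
    fix e assume e: "e \<in> E"
    have "cmod (cinner (T e) (g e)) \<le> ?A e powr (1 / p) * D"
      using assms cmod_multiplier_form_le[of e "g e"] orthonormal_family_norm[OF E(2) e]
        orthonormal_family_norm[OF E(3) e]
      by (simp add: is_multiplier_def multiplier_form_def D_def powr_powr)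
    then have "cmod (cinner (T e) (g e)) powr p \<le> (?A e powr (1 / p) * D) powr p"
      using p by (intro powr_mono2) auto
    also have "\<dots> = ?A e * D powr p"
      using p integral_symbol_coeff_product_nonneg by (simp add: powr_mult powr_powr)
    finally show "cmod (cinner (T e) (g e)) powr p \<le> ?A e * D powr p" .
  qed
  also have "\<dots> = (\<Sum>e\<in>E. ?A e) * D powr p"
    by (simp add: sum_distrib_right)
  also have "\<dots> \<le> (LINT \<omega>|M. cmod (m \<omega>) powr p) * \<bar>L\<^sub>F * L\<^sub>G\<bar> * D powr p"
    by (intro mult_right_mono sum_integral_symbol_coeff_product_le E) auto
  finally show "(\<Sum>e\<in>E. cmod (cinner (T e) (g e)) powr p) \<le>
    (LINT \<omega>|M. cmod (m \<omega>) powr p) * \<bar>L\<^sub>F * L\<^sub>G\<bar> * ((B\<^sub>F * B\<^sub>G) powr (1 / (2 * q))) powr p"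
    by (simp add: D_def)
qed

end

theorem theorem3p11:
  fixes M :: "'w measure"
    and F G :: "'w \<Rightarrow> 'a::complex_hilbert"
    and m :: "'w \<Rightarrow> complex"
    and p q L\<^sub>F L\<^sub>G B\<^sub>F B\<^sub>G :: real
  assumes "bessel_mapping M F B\<^sub>F" and "bessel_mapping M G B\<^sub>G"
    and "norm_bounded_mapping M F L\<^sub>F" and "norm_bounded_mapping M G L\<^sub>G"
    and "1 < p" and "1 / p + 1 / q = 1"
    and "in_Lp p M m"
  shows "multiplier_well_defined M m F G \<and>
    bounded_clinear (multiplier M m F G) \<and>
    multiplier M m F G \<in> schatten_class p \<and>
    schatten_norm p (multiplier M m F G)
      \<le> Lp_norm p M m * (L\<^sub>F * L\<^sub>G) powr (1 / p) * (B\<^sub>F * B\<^sub>G) powr (1 / (2 * q))"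
proof -
  obtain T where T: "bounded_clinear T" "is_multiplier M m F G T"
    using multiplier_operator[OF assms] by metis
  have ex1: "\<exists>!T. is_multiplier M m F G T"
    using T(2) is_multiplier_unique[OF assms] by blast
  have eq: "multiplier M m F G = T"
    unfolding multiplier_def using the1_equality[OF ex1, OF T(2)] by simp
  let ?C = "(LINT \<omega>|M. cmod (m \<omega>) powr p) * \<bar>L\<^sub>F * L\<^sub>G\<bar> * ((B\<^sub>F * B\<^sub>G) powr (1 / (2 * q))) powr p"
  have sums: "diagonal_sums_bounded p T ?C"
    by (rule is_multiplier_diagonal_sums_bounded[OF assms T(2)])
  have "0 < p" using assms(5) by simp
  note schatten = diagonal_sums_bounded_imp_schatten[OF this sums T(1)]
  have "?C powr (1 / p) = Lp_norm p M m * (L\<^sub>F * L\<^sub>G) powr (1 / p) * (B\<^sub>F * B\<^sub>G) powr (1 / (2 * q))"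
    using \<open>0 < p\<close> by (simp add: Lp_norm_def powr_mult powr_powr abs_if uminus_powr_eq)
  with schatten T(1) ex1 integrable_multiplier_integrand[OF assms] show ?thesis
    by (simp add: eq multiplier_well_defined_def)
qed

end
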